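(* For $a, b \in \mathbb{N}_0$ and $c \in \{1, 3, 5\}$ let $$RR_1(a,b,c)=\frac{(6a+1)\cdot 2^{\,2\left(3b+\left((c-1+(a \bmod 3))\bmod 3\right)\right)+2}-1}{3}.$$ Then $RR_1$ is a function $\mathbb{N}_0 \times \mathbb{N}_0 \times \{1, 3, 5\} \to \mathbb{O}_{R1}$, and $RR_1(a,b,c) \equiv c \pmod{6}$ for all $a,b\in\mathbb{N}_0$ and $c\in\{1,3,5\}$.
   Context: $\mathbb{N}_0$ denotes the nonnegative integers. $x \bmod 3\in\{0,1,2\}$ is the remainder of $x$ modulo $3$. The function $R_1$ is defined for $a,b\in\mathbb{N}_0$ by $R_1(a,b) = \frac{(6a+1)\cdot 2^{2b+2}-1}{3}$, and $\mathbb{O}_{R1} = \{R_1(a,b) : a,b\in\mathbb{N}_0\}$, a subset of the positive odd integers. *)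

theory Defs
  imports Complex_Main "HOL-Library.FuncSet" "HOL-Number_Theory.Cong"
begin

text \<open>
  The quotients are taken in the rationals, so that the integrality of the values is a
  theorem and is not hidden by the truncating division on the natural numbers.
\<close>

definition R1 :: "nat \<Rightarrow> nat \<Rightarrow> rat" where
  "R1 a b = ((6 * of_nat a + 1) * 2 ^ (2 * b + 2) - 1) / 3"

definition O_R1 :: "rat set" where
  "O_R1 = {R1 a b | a b. True}"

text \<open>The subtraction \<open>c - 1\<close> is on the naturals; it does not truncate for \<open>c \<in> {1, 3, 5}\<close>.\<close>

definition RR1 :: "nat \<Rightarrow> nat \<Rightarrow> nat \<Rightarrow> rat" where
  "RR1 a b c =
     ((6 * of_nat a + 1) * 2 ^ (2 * (3 * b + ((c - 1 + (a mod 3)) mod 3)) + 2) - 1) / 3"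

lemma O_R1_subset_odd: "O_R1 \<subseteq> of_nat ` {n :: nat. odd n}"
proof
  fix x assume "x \<in> O_R1"
  then obtain a b where x: "x = R1 a b"
    by (auto simp: O_R1_def)
  define N :: nat where "N = (6 * a + 1) * 2 ^ (2 * b + 2)"
  have "[4 ^ (b + 1) = 1 ^ (b + 1)] (mod 3 :: nat)"
    by (rule cong_pow) (simp add: cong_def)
  moreover have "[6 * a + 1 = 1] (mod 3)"
    by (simp add: cong_def mod_Suc mod_mult_left_eq[symmetric])
  moreover have N: "N = (6 * a + 1) * 4 ^ (b + 1)"
    by (simp add: N_def power_add power_mult)
  ultimately have "[N = 1] (mod 3)"
    using cong_mult by fastforce
  then have "N mod 3 = 1"
    by (simp add: cong_def)
  then have n: "N = 3 * (N div 3) + 1"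
    by presburger
  have "even N"
    by (simp add: N)
  with n have "odd (N div 3)"
    by presburger
  moreover have "x = of_nat (N div 3)"
  proof -
    have "(of_nat N :: rat) = 3 * of_nat (N div 3) + 1"
      by (subst n) simp
    moreover have "x = (of_nat N - 1) / 3"
      by (simp add: x R1_def N_def algebra_simps)
    ultimately show ?thesis
      by simp
  qed
  ultimately show "x \<in> of_nat ` {n. odd n}"
    by blast
qed

end

theory Submission
  imports Defs
begin

text \<open>
  Write \<open>RR1 a b c = (N - 1) / 3\<close>. The claim \<open>RR1 a b c \<equiv> c (mod 6)\<close> is equivalent to
  \<open>N \<equiv> 3 c + 1 (mod 18)\<close>. Since \<open>4 * 64 \<equiv> 4 (mod 18)\<close>, the residue of \<open>N\<close> does not depend on \<open>b\<close>,
  and it depends on \<open>a\<close> only through \<open>a mod 3\<close>; this leaves nine cases.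
\<close>

lemma RR1_eq_R1: "RR1 a b c = R1 a (3 * b + (c - 1 + a mod 3) mod 3)"
  by (simp add: RR1_def R1_def)

text \<open>The factor 4 matters: 64 is 1 modulo 9 but 10 modulo 18, and an even factor lifts the
  congruence from 9 to 18.\<close>

lemma four_mult_64_power_cong: "[4 * 64 ^ b = 4] (mod 18 :: nat)"
proof (induction b)
  case (Suc b)
  have "[64 * (4 * 64 ^ b) = 64 * 4] (mod 18 :: nat)"
    by (intro cong_mult Suc.IH cong_refl)
  then show ?case
    by (simp add: cong_def)
qed simp

lemma R1_numerator_cong:
  "[(6 * a + 1) * 2 ^ (2 * (3 * b + r) + 2) = (6 * (a mod 3) + 1) * (4 * 4 ^ r)] (mod 18 :: nat)"
proof -
  have "(2 :: nat) ^ (2 * (3 * b + r) + 2) = 4 * 64 ^ b * 4 ^ r"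
    by (simp add: power_add power_mult)
  moreover have "[4 * 64 ^ b * 4 ^ r = 4 * 4 ^ r] (mod 18 :: nat)"
    by (intro cong_mult four_mult_64_power_cong cong_refl)
  moreover have "[6 * a + 1 = 6 * (a mod 3) + 1] (mod 18)"
    using mult_mod_right[of 6 a 3] by (simp add: cong_def mod_simps)
  ultimately show ?thesis
    by (simp only: cong_mult)
qed

text \<open>Modulo 9, 4 has order 3 and \<open>6 * a + 1\<close> is inverse to
  \<open>4 ^ (a mod 3)\<close>. The shift by \<open>a mod 3\<close> in the exponent cancels this
  factor and leaves \<open>4 ^ c\<close>, which is \<open>3 * c + 1\<close> by expanding
  \<open>(1 + 3) ^ c\<close>. Modulo 2 both sides vanish, as \<open>c\<close> is odd.\<close>

lemma RR1_numerator_cong: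
  fixes a b c :: nat
  assumes "c \<in> {1, 3, 5}"
  shows "[(6 * a + 1) * 2 ^ (2 * (3 * b + (c - 1 + a mod 3) mod 3) + 2) = 3 * c + 1] (mod 18)"
proof -
  have "a mod 3 = 0 \<or> a mod 3 = 1 \<or> a mod 3 = 2"
    by auto
  with assms have "[(6 * (a mod 3) + 1) * (4 * 4 ^ ((c - 1 + a mod 3) mod 3)) = 3 * c + 1] (mod 18)"
    by (elim disjE insertE emptyE) (simp_all add: cong_def)
  with R1_numerator_cong show ?thesis
    by (rule cong_trans)
qed

lemma RR1_cong:
  assumes c: "c \<in> {1, 3, 5}"
  shows "\<exists>n :: nat. RR1 a b c = of_nat n \<and> [n = c] (mod 6)"
proof -
  define N where "N = (6 * a + 1) * 2 ^ (2 * (3 * b + (c - 1 + a mod 3) mod 3) + 2)"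
  \<comment> \<open>For these \<open>c\<close>, \<open>3 * c + 1\<close> is at most 16, hence its
    own remainder modulo 18.\<close>
  have "N mod 18 = 3 * c + 1"
    using RR1_numerator_cong[OF c, of a b] c unfolding N_def[symmetric] by (auto simp: cong_def)
  then obtain q where "N = 18 * q + (3 * c + 1)"
    by (metis mult_div_mod_eq)
  then have "(of_nat N :: rat) = 3 * of_nat (6 * q + c) + 1"
    by simp
  moreover have "RR1 a b c = (of_nat N - 1) / 3"
    by (simp add: RR1_def N_def algebra_simps)
  ultimately have "RR1 a b c = of_nat (6 * q + c)"
    by simp
  moreover have "[6 * q + c = c] (mod 6)"
    by (simp add: cong_def)
  ultimately show ?thesis
    by blast
qed

theorem theorem5p17:
  shows "(\<lambda>(a, b, c). RR1 a b c) \<in> UNIV \<times> UNIV \<times> {1, 3, 5} \<rightarrow> O_R1 \<and>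
    (\<forall>a b. \<forall>c \<in> {1, 3, 5}. \<exists>n :: nat. RR1 a b c = of_nat n \<and> [n = c] (mod 6))"
proof
  show "(\<lambda>(a, b, c). RR1 a b c) \<in> UNIV \<times> UNIV \<times> {1, 3, 5} \<rightarrow> O_R1"
    by (auto simp: O_R1_def RR1_eq_R1)
  show "\<forall>a b. \<forall>c \<in> {1, 3, 5}. \<exists>n :: nat. RR1 a b c = of_nat n \<and> [n = c] (mod 6)"
    using RR1_cong by blast
qed

end
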